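(* Let $\kappa\in\mathbb{R}$ and $\lambda>0$. For every integer $n\ge0$, $$Q_n^{(1)}(\kappa,\lambda;w,\overline w)=w^n+\sum_{j=1}^{n}\frac{\kappa^2(n-j+1)}{\lambda(\lambda+n)}\;{}_4F_3\left({1-j,\;j-n,\;1-\kappa,\;1+\kappa\atop 2,\;\lambda+1,\;-\lambda-n+1};1\right)w^{n-j}\overline w^{j},$$ $$Q_n^{(2)}(\kappa,\lambda;w,\overline w)=\sum_{j=0}^{n}\frac{\kappa}{\lambda+j}\;{}_4F_3\left({-j,\;j-n,\;-\kappa,\;\kappa\atop 1,\;\lambda,\;-\lambda-n};1\right)w^{n-j}\overline w^{j}.$$
   Context: The polynomials $Q_n^{(1)},Q_n^{(2)}$ in two variables $w,\overline w$ are defined recursively by $Q_0^{(1)}(\kappa,\lambda;w,\overline w)=1$, $Q_0^{(2)}(\kappa,\lambda;w,\overline w)=\frac{\kappa}{\lambda}$, and for $n\ge0$ $$Q_{n+1}^{(1)}(\kappa,\lambda;w,\overline w)=wQ_n^{(1)}(\kappa,\lambda;w,\overline w)+\frac{\kappa}{\lambda+n+1}\overline wQ_n^{(2)}(\kappa,\lambda;\overline w,w),$$ $$Q_{n+1}^{(2)}(\kappa,\lambda;w,\overline w)=\frac{\kappa}{\lambda+n+1}\overline wQ_n^{(1)}(\kappa,\lambda;\overline w,w)+wQ_n^{(2)}(\kappa,\lambda;w,\overline w).$$ The terminating hypergeometric series is ${}_4F_3\left({a_1,a_2,a_3,a_4\atop b_1,b_2,b_3};1\right)=\sum_i\frac{(a_1)_i(a_2)_i(a_3)_i(a_4)_i}{(b_1)_i(b_2)_i(b_3)_i\,i!}$,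 with $(a)_i=a(a+1)\cdots(a+i-1)$, summed over $i\ge0$ until the first vanishing of a numerator factor (here $a_1$ or $a_2$ is a nonpositive integer terminating the sum). *)

theory Defs
  imports Complex_Main "HOL-Computational_Algebra.Formal_Power_Series"
begin

text \<open>
  The two variables are independent complex numbers \<open>w\<close> and \<open>v\<close>, with \<open>v\<close> in the role of the
  conjugate of \<open>w\<close>. An identity for all \<open>w\<close> and \<open>v\<close> is an identity of polynomials in two
  variables, and \<open>v = cnj w\<close> is a special case.
\<close>

fun Q1 :: "real \<Rightarrow> real \<Rightarrow> nat \<Rightarrow> complex \<Rightarrow> complex \<Rightarrow> complex"
  and Q2 :: "real \<Rightarrow> real \<Rightarrow> nat \<Rightarrow> complex \<Rightarrow> complex \<Rightarrow> complex" where
  "Q1 \<kappa> lam 0 w v = 1"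
| "Q2 \<kappa> lam 0 w v = of_real (\<kappa> / lam)"
| "Q1 \<kappa> lam (Suc n) w v =
     w * Q1 \<kappa> lam n w v + of_real (\<kappa> / (lam + real n + 1)) * v * Q2 \<kappa> lam n v w"
| "Q2 \<kappa> lam (Suc n) w v =
     of_real (\<kappa> / (lam + real n + 1)) * v * Q1 \<kappa> lam n v w + w * Q2 \<kappa> lam n w v"

text \<open>
  A terminating hypergeometric series, summed up to the first index at which a numerator factor
  vanishes. If \<open>pochhammer a i = 0\<close> then \<open>pochhammer a k = 0\<close> for all \<open>k \<ge> i\<close>, so the index set
  is an initial segment of the naturals; it is finite iff some upper parameter is a nonpositive
  integer. Lower parameters that are nonpositive integers are harmless as long as their
  Pochhammer symbols vanish only beyond this segment.
\<close>

definition hypergeo_terminating :: "real list \<Rightarrow> real list \<Rightarrow> real \<Rightarrow> real" where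
  "hypergeo_terminating as bs z =
     (\<Sum>i | \<forall>a\<in>set as. pochhammer a i \<noteq> 0. fps_nth (fps_hypergeo as bs z) i)"

end

theory Submission
  imports Defs
begin

text \<open>
  Comparing coefficients, the recursion reads
  \<open>\<alpha>(J, P + 1) - \<alpha>(J, P) = \<kappa> / (\<lambda> + J + P + 1) * \<beta>(P, J)\<close> and
  \<open>\<beta>(J, P + 1) - \<beta>(J, P) = \<kappa> / (\<lambda> + J + P + 1) * \<alpha>(P, J)\<close>, where \<open>\<alpha>(J, P)\<close> is the coefficient
  of \<open>w\<^sup>P\<^sup>-\<^sup>1 v\<^sup>J\<^sup>+\<^sup>1\<close> in the first polynomial of index \<open>J + P\<close> and \<open>\<beta>(J, P)\<close> that of \<open>w\<^sup>P v\<^sup>J\<close> in the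
  second. For the hypergeometric expressions the second relation holds term by term after an index
  shift. In the first one, the difference of the \<open>i\<close>-th terms of both sides is, up
  to a factor independent of \<open>i\<close>, \<open>(i + 1)\<^sup>2 t (i + 1) - i\<^sup>2 t i\<close>, with \<open>t\<close> the summand of \<open>\<beta>(P, J)\<close>, so the sum telescopes to zero.
\<close>

section \<open>Terminating series as finite sums over any sufficiently long range\<close>

lemma hypergeo_terminating_eq_sum:
  assumes "a \<in> set as" "pochhammer a N = 0"
  shows "hypergeo_terminating as bs z = (\<Sum>i<N. fps_nth (fps_hypergeo as bs z) i)"
proof -
  \<comment> \<open>The numerator of a term is a \<open>foldl\<close>; pulling out its accumulator
    turns it into a product with a zero factor. The quotient is then 0 whatever the denominator,
    since \<open>0 / 0 = 0\<close>.\<close>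
  have zero: "fps_nth (fps_hypergeo as bs z) i = 0" if "b \<in> set as" "pochhammer b i = 0" for b i
  proof -
    have "foldl (\<lambda>r a. r * pochhammer a i) c xs = c * (\<Prod>a\<leftarrow>xs. pochhammer a i)"
      for c :: real and xs
      by (induction xs arbitrary: c) (simp_all add: mult.assoc)
    moreover have "(\<Prod>a\<leftarrow>as. pochhammer a i) = 0"
      unfolding prod_list_zero_iff set_map by (rule image_eqI) (use that in simp_all)
    ultimately show ?thesis
      by (simp only: fps_hypergeo_nth mult_zero_right mult_zero_left div_0)
  qed
  show ?thesis
    unfolding hypergeo_terminating_def
  proof (rule sum.mono_neutral_left)
    have "i < N" if "pochhammer a i \<noteq> 0" for i
      using that pochhammer_eq_0_mono[OF assms(2), of i] by (cases "i < N") auto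
    then show "{i. \<forall>a\<in>set as. pochhammer a i \<noteq> 0} \<subseteq> {..<N}"
      using assms(1) by auto
    show "\<forall>i\<in>{..<N} - {i. \<forall>a\<in>set as. pochhammer a i \<noteq> 0}. fps_nth (fps_hypergeo as bs z) i = 0"
      using zero by blast
  qed simp
qed

lemma hypergeo_terminating_4_3:
  assumes "pochhammer a1 N = 0 \<or> pochhammer a2 N = 0"
  shows "hypergeo_terminating [a1, a2, a3, a4] [b1, b2, b3] 1 =
    (\<Sum>i<N. pochhammer a1 i * pochhammer a2 i * pochhammer a3 i * pochhammer a4 i /
       (pochhammer b1 i * pochhammer b2 i * pochhammer b3 i * fact i))"
proof -
  let ?as = "[a1, a2, a3, a4]" and ?bs = "[b1, b2, b3]"
  have "a1 \<in> set ?as" "a2 \<in> set ?as"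
    by simp_all
  with assms have "hypergeo_terminating ?as ?bs 1 = (\<Sum>i<N. fps_nth (fps_hypergeo ?as ?bs 1) i)"
    using hypergeo_terminating_eq_sum by blast
  also have "\<dots> = (\<Sum>i<N. pochhammer a1 i * pochhammer a2 i * pochhammer a3 i * pochhammer a4 i /
       (pochhammer b1 i * pochhammer b2 i * pochhammer b3 i * fact i))"
    by (rule sum.cong) simp_all
  finally show ?thesis .
qed

text \<open>Used with \<open>m = P\<close> and \<open>x = l + J + P\<close>, where a step from
  \<open>P\<close> to \<open>P + 1\<close> lowers both parameters by one. Over a common denominator
  the claim reduces to (-m - 1)(i - x) - (i - m)(-x - 1) = (x - m)(i + 1). The factors -x - 1, ...,
  i - x in the hypothesis include those of both denominators.\<close>

lemma pochhammer_ratio_diff: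
  fixes m x :: real
  assumes "pochhammer (- x - 1) (i + 2) \<noteq> 0"
  shows "pochhammer (- m - 1) (Suc i) / pochhammer (- x - 1) (Suc i) -
      pochhammer (- m) (Suc i) / pochhammer (- x) (Suc i) =
    - ((x - m) * (real i + 1) * pochhammer (- m) i / ((x + 1) * pochhammer (- x) (Suc i)))"
proof -
  define p q where "p = pochhammer (- m) i" and "q = pochhammer (- x) i"
  have rec: "pochhammer (- y - 1) (Suc k) = (- y - 1) * pochhammer (- y) k" for y :: real and k
    using pochhammer_rec[of "- y - 1" k] by (simp only: diff_add_cancel)
  have "pochhammer (- x - 1) (i + 2) = (- x - 1) * (q * (real i - x))"
    using rec[of x "Suc i"] by (simp only: q_def pochhammer_Suc[of "- x" i] add_2_eq_Suc'
        add.commute[of "- x"] diff_conv_add_uminus)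
  with assms have nz: "x + 1 \<noteq> 0" "q \<noteq> 0" "real i - x \<noteq> 0" "- x - 1 \<noteq> 0"
    by auto
  have e: "pochhammer (- m - 1) (Suc i) = (- m - 1) * p"
    "pochhammer (- x - 1) (Suc i) = (- x - 1) * q"
    "pochhammer (- m) (Suc i) = p * (real i - m)"
    "pochhammer (- x) (Suc i) = q * (real i - x)"
    by (simp_all only: p_def q_def rec) (simp_all add: pochhammer_Suc)
  define W where "W = p / (q * (real i - x) * (- x - 1))"
  have "(- m - 1) * p / ((- x - 1) * q) = W * ((- m - 1) * (real i - x))"
    "p * (real i - m) / (q * (real i - x)) = W * ((real i - m) * (- x - 1))"
    using nz by (simp_all add: W_def mult.commute)
  moreover have "- ((x - m) * (real i + 1) * p / ((x + 1) * (q * (real i - x)))) =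
      W * ((x - m) * (real i + 1))"
  proof -
    have "q * (real i - x) * (- x - 1) = - ((x + 1) * (q * (real i - x)))"
      by (simp add: algebra_simps)
    then show ?thesis
      by (simp only: W_def minus_divide_right times_divide_eq_left times_divide_eq_right mult_ac)
  qed
  moreover have "W * ((- m - 1) * (real i - x)) - W * ((real i - m) * (- x - 1)) =
      W * ((x - m) * (real i + 1))"
    by (simp add: algebra_simps)
  ultimately show ?thesis
    by (simp only: e p_def[symmetric])
qed

lemma pochhammer_neg_ne_0:
  assumes "real k < x + 1"
  shows "pochhammer (- x) k \<noteq> (0::real)"
  using assms by (auto simp: pochhammer_eq_0_iff)

section \<open>Coefficient functions and their summands\<close>

definition alpha :: "real \<Rightarrow> real \<Rightarrow> nat \<Rightarrow> nat \<Rightarrow> real" where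
  "alpha \<kappa> l J P = \<kappa>\<^sup>2 * real P / (l * (l + real (J + P))) *
     hypergeo_terminating [- real J, 1 - real P, 1 - \<kappa>, 1 + \<kappa>] [2, l + 1, - l - real (J + P) + 1] 1"

definition beta :: "real \<Rightarrow> real \<Rightarrow> nat \<Rightarrow> nat \<Rightarrow> real" where
  "beta \<kappa> l J P = \<kappa> / (l + real J) *
     hypergeo_terminating [- real J, - real P, - \<kappa>, \<kappa>] [1, l, - l - real (J + P)] 1"

text \<open>This boundary value would belong to the exponent -1 of \<open>w\<close>. Being 0, it
  lets sums be extended by one index or lose an end term.\<close>

lemma alpha_0_right [simp]: "alpha \<kappa> l J 0 = 0"
  by (simp add: alpha_def)

text \<open>The prefactor \<open>P / (l + J + P)\<close> is absorbed into two Pochhammer symbols,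
  raising their index by one. Then \<open>P\<close> enters only through a ratio as in
  \<open>pochhammer_ratio_diff\<close>. The free bound \<open>N\<close> gives the sums for
  \<open>P\<close> and \<open>Suc P\<close> a common range.\<close>

lemma alpha_eq_sum:
  assumes "J < N \<or> P \<le> N"
  shows "alpha \<kappa> l J P = (\<Sum>i<N. \<kappa>\<^sup>2 / l *
    (pochhammer (- real J) i * pochhammer (1 - \<kappa>) i * pochhammer (1 + \<kappa>) i /
      (fact (Suc i) * pochhammer (l + 1) i * fact i)) *
    (pochhammer (- real P) (Suc i) / pochhammer (- (l + real (J + P))) (Suc i)))"
\<comment> \<open>For \<open>P = 0\<close> the parameter \<open>1 - real P\<close> is 1 and does not
  end the series; the left side is 0 by its prefactor, the right side because
  \<open>pochhammer 0 (Suc i) = 0\<close>.\<close>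
proof (cases "P = 0")
  case True
  then show ?thesis
    by (simp add: pochhammer_rec)
next
  case False
  have two: "fact (Suc i) = pochhammer (2 :: real) i" for i
    using pochhammer_rec[of "1 :: real" i] by (simp only: pochhammer_fact) simp
  have "1 - real P = - real (P - 1)"
    using False by simp
  with assms False have "pochhammer (- real J) N = 0 \<or> pochhammer (1 - real P) N = 0"
    by (auto simp: pochhammer_of_nat_eq_0_iff simp del: of_nat_diff)
  note series = hypergeo_terminating_4_3[OF this]
  have "alpha \<kappa> l J P = (\<Sum>i<N. \<kappa>\<^sup>2 * real P / (l * (l + real (J + P))) *
      (pochhammer (- real J) i * pochhammer (1 - real P) i * pochhammer (1 - \<kappa>) i *
         pochhammer (1 + \<kappa>) i /
       (pochhammer 2 i * pochhammer (l + 1) i * pochhammer (- l - real (J + P) + 1) i * fact i)))"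
    unfolding alpha_def series sum_distrib_left by (rule refl)
  also have "\<dots> = (\<Sum>i<N. \<kappa>\<^sup>2 / l *
    (pochhammer (- real J) i * pochhammer (1 - \<kappa>) i * pochhammer (1 + \<kappa>) i /
      (pochhammer 2 i * pochhammer (l + 1) i * fact i)) *
    (pochhammer (- real P) (Suc i) / pochhammer (- (l + real (J + P))) (Suc i)))"
  proof (rule sum.cong[OF refl])
    fix i
    have P: "pochhammer (- real P) (Suc i) = - real P * pochhammer (1 - real P) i"
      using pochhammer_rec[of "- real P" i] by (simp add: add.commute)
    have x: "pochhammer (- (l + real (J + P))) (Suc i) =
        - (l + real (J + P)) * pochhammer (- l - real (J + P) + 1) i"
      by (simp only: pochhammer_rec minus_add_distrib diff_conv_add_uminus)
    show "\<kappa>\<^sup>2 * real P / (l * (l + real (J + P))) *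
      (pochhammer (- real J) i * pochhammer (1 - real P) i * pochhammer (1 - \<kappa>) i *
         pochhammer (1 + \<kappa>) i /
       (pochhammer 2 i * pochhammer (l + 1) i * pochhammer (- l - real (J + P) + 1) i * fact i)) =
      \<kappa>\<^sup>2 / l *
    (pochhammer (- real J) i * pochhammer (1 - \<kappa>) i * pochhammer (1 + \<kappa>) i /
      (pochhammer 2 i * pochhammer (l + 1) i * fact i)) *
    (pochhammer (- real P) (Suc i) / pochhammer (- (l + real (J + P))) (Suc i))"
      unfolding P x by (simp only: mult_minus_left minus_divide_divide times_divide_times_eq mult_ac)
  qed
  finally show ?thesis
    by (simp only: two)
qed

lemma beta_eq_sum:
  assumes "J < N \<or> P < N"
  shows "beta \<kappa> l J P = (\<Sum>i<N. \<kappa> / (l + real J) *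
    (pochhammer (- real J) i * pochhammer (- \<kappa>) i * pochhammer \<kappa> i /
      (fact i * pochhammer l i * fact i)) *
    (pochhammer (- real P) i / pochhammer (- (l + real (J + P))) i))"
proof -
  have "pochhammer (- real J) N = 0 \<or> pochhammer (- real P) N = 0"
    using assms by (simp add: pochhammer_of_nat_eq_0_iff)
  note series = hypergeo_terminating_4_3[OF this]
  have "- l - real (J + P) = - (l + real (J + P))"
    by simp
  then show ?thesis
    unfolding beta_def series sum_distrib_left pochhammer_fact
    by (intro sum.cong refl) (simp only: times_divide_times_eq times_divide_eq_right divide_divide_eq_left mult_ac)
qed

section \<open>Initial value and recursions of the coefficients in the second argument\<close>

lemma beta_0_right: "beta \<kappa> l J 0 = \<kappa> / (l + real J)"
  by (simp add: beta_eq_sum[where N = 1])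

text \<open>In the term of index \<open>i + 1\<close> the factor \<open>x - P = l + J\<close> from
  \<open>pochhammer_ratio_diff\<close> cancels the denominator of the prefactor of
  \<open>beta\<close>. The minus sign there meets the one in (-\<kappa>)_(i+1) (\<kappa>)_(i+1) =
  -\<kappa>^2 (1-\<kappa>)_i (1+\<kappa>)_i, which leaves the term of index \<open>i\<close> of
  \<open>alpha\<close>.\<close>

lemma beta_Suc_right:
  assumes "l > 0"
  shows "beta \<kappa> l J (Suc P) = beta \<kappa> l J P + \<kappa> / (l + real (J + P) + 1) * alpha \<kappa> l P J"
proof -
  define x where "x = l + real (J + P)"
  define c where "c i = \<kappa> / (l + real J) *
    (pochhammer (- real J) i * pochhammer (- \<kappa>) i * pochhammer \<kappa> i /
      (fact i * pochhammer l i * fact i))" for i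
  have x': "- (l + real (J + Suc P)) = - x - 1" "- real (Suc P) = - real P - 1"
    by (simp_all add: x_def)
  have "beta \<kappa> l J (Suc P) - beta \<kappa> l J P =
      (\<Sum>i<Suc J. c i * (pochhammer (- real P - 1) i / pochhammer (- x - 1) i -
         pochhammer (- real P) i / pochhammer (- x) i))"
    by (simp only: beta_eq_sum[of J "Suc J"] lessI simp_thms x' sum_subtractf[symmetric]
        right_diff_distrib c_def x_def[symmetric])
  \<comment> \<open>The term of index 0 drops out, since both ratios of empty products are
    1.\<close>
  also have "\<dots> = (\<Sum>i<J. c (Suc i) * (pochhammer (- real P - 1) (Suc i) / pochhammer (- x - 1) (Suc i) -
         pochhammer (- real P) (Suc i) / pochhammer (- x) (Suc i)))"
    by (simp only: sum.lessThan_Suc_shift) simp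
  also have "\<dots> = (\<Sum>i<J. \<kappa> / (x + 1) * (\<kappa>\<^sup>2 / l *
    (pochhammer (- real P) i * pochhammer (1 - \<kappa>) i * pochhammer (1 + \<kappa>) i /
      (fact (Suc i) * pochhammer (l + 1) i * fact i)) *
    (pochhammer (- real J) (Suc i) / pochhammer (- (l + real (P + J))) (Suc i))))"
  proof (rule sum.cong[OF refl])
    fix i assume "i \<in> {..<J}"
    then have i: "i < J" by simp
    define Q R where "Q = pochhammer (1 - \<kappa>) i" and "R = pochhammer (1 + \<kappa>) i"
    define L F where "L = pochhammer (l + 1) i" and "F = (fact i :: real)"
    define A B X where "A = pochhammer (- real J) (Suc i)" and "B = pochhammer (- real P) i"
      and "X = pochhammer (- x) (Suc i)"
    have "pochhammer (- x - 1) (i + 2) \<noteq> 0"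
      using pochhammer_neg_ne_0[of "i + 2" "x + 1"] i assms by (simp add: x_def)
    note d = pochhammer_ratio_diff[OF this, of "real P"]
    have X0: "X \<noteq> 0"
      unfolding X_def using i assms by (intro pochhammer_neg_ne_0) (simp add: x_def)
    have nz: "L \<noteq> 0" "F \<noteq> 0" "x + 1 \<noteq> 0" "l + real J \<noteq> 0" "l \<noteq> 0" "real i + 1 \<noteq> 0"
      using assms pochhammer_pos[of "l + 1" i] by (auto simp: L_def F_def x_def)
    have e: "pochhammer (- \<kappa>) (Suc i) = - \<kappa> * Q" "pochhammer \<kappa> (Suc i) = \<kappa> * R"
        "pochhammer l (Suc i) = l * L" "fact (Suc i) = (real i + 1) * F"
      by (simp_all add: pochhammer_rec Q_def R_def L_def F_def add.commute)
    have xP: "x - real P = l + real J" "l + real (P + J) = x"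
      by (simp_all add: x_def)
    show "c (Suc i) * (pochhammer (- real P - 1) (Suc i) / pochhammer (- x - 1) (Suc i) -
         pochhammer (- real P) (Suc i) / pochhammer (- x) (Suc i)) =
      \<kappa> / (x + 1) * (\<kappa>\<^sup>2 / l *
    (pochhammer (- real P) i * pochhammer (1 - \<kappa>) i * pochhammer (1 + \<kappa>) i /
      (fact (Suc i) * pochhammer (l + 1) i * fact i)) *
    (pochhammer (- real J) (Suc i) / pochhammer (- (l + real (P + J))) (Suc i)))"
      unfolding d unfolding c_def e xP Q_def[symmetric] R_def[symmetric] L_def[symmetric] F_def[symmetric]
        A_def[symmetric] B_def[symmetric] X_def[symmetric]
      using nz X0 by (simp add: divide_simps power2_eq_square)
  qed
  \<comment> \<open>After the shift only \<open>J\<close> terms remain; they suffice because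
    \<open>alpha_eq_sum\<close> allows its bound to equal the second argument of
    \<open>alpha\<close>, here \<open>J\<close>.\<close>
  also have "\<dots> = \<kappa> / (x + 1) * alpha \<kappa> l P J"
    by (simp add: alpha_eq_sum[of P J J] sum_distrib_left)
  finally show ?thesis
    by (simp add: x_def)
qed

text \<open>Here the terms do not match one by one: each differs by an increment of
  \<open>g\<close>, and these increments sum to \<open>g (Suc J) - g 0\<close>.\<close>

lemma alpha_Suc_right:
  assumes "l > 0"
  shows "alpha \<kappa> l J (Suc P) = alpha \<kappa> l J P + \<kappa> / (l + real (J + P) + 1) * beta \<kappa> l P J"
proof -
  define x where "x = l + real (J + P)"
  define c where "c i = \<kappa>\<^sup>2 / l *
    (pochhammer (- real J) i * pochhammer (1 - \<kappa>) i * pochhammer (1 + \<kappa>) i /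
      (fact (Suc i) * pochhammer (l + 1) i * fact i))" for i
  define b where "b i = \<kappa> / (l + real P) *
    (pochhammer (- real P) i * pochhammer (- \<kappa>) i * pochhammer \<kappa> i /
      (fact i * pochhammer l i * fact i)) *
    (pochhammer (- real J) i / pochhammer (- (l + real (P + J))) i)" for i
  \<comment> \<open>The square cancels the new factors of both factorials in
    \<open>g (Suc i)\<close> and gives \<open>g 0 = 0\<close>. At the other end,
    \<open>pochhammer (- real J) (Suc J) = 0\<close> gives \<open>g (Suc J) = 0\<close>.\<close>
  define g where "g i = (real i)\<^sup>2 *
    (pochhammer (- real J) i * pochhammer (- real P) i * pochhammer (- \<kappa>) i * pochhammer \<kappa> i /
      (fact i * pochhammer l i * fact i * pochhammer (- x) i))" for i
  have x': "- (l + real (J + Suc P)) = - x - 1" "- real (Suc P) = - real P - 1"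
    by (simp_all add: x_def)
  have "alpha \<kappa> l J (Suc P) - alpha \<kappa> l J P =
      (\<Sum>i<Suc J. c i * (pochhammer (- real P - 1) (Suc i) / pochhammer (- x - 1) (Suc i) -
         pochhammer (- real P) (Suc i) / pochhammer (- x) (Suc i)))"
    by (simp only: alpha_eq_sum[of J "Suc J"] lessI simp_thms x' sum_subtractf[symmetric]
        right_diff_distrib c_def x_def[symmetric])
  also have "\<dots> = (\<Sum>i<Suc J. \<kappa> / (x + 1) * b i +
      (g (Suc i) - g i) / ((x + 1) * (l + real P)))"
  proof (rule sum.cong[OF refl])
    fix i assume "i \<in> {..<Suc J}"
    then have i: "i \<le> J" by simp
    define r where "r = real i"
    define C D where "C = pochhammer (- \<kappa>) i" and "D = pochhammer \<kappa> i"
    define L F where "L = pochhammer l i" and "F = (fact i :: real)"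
    define A B X where "A = pochhammer (- real J) i" and "B = pochhammer (- real P) i"
      and "X = pochhammer (- x) i"
    define j p where "j = real J" and "p = real P"
    \<comment> \<open>The index \<open>i = J\<close> occurs here, and \<open>i < x\<close> holds as
      \<open>l > 0\<close>.\<close>
    have "pochhammer (- x - 1) (i + 2) \<noteq> 0"
      using pochhammer_neg_ne_0[of "i + 2" "x + 1"] i assms by (simp add: x_def)
    note d = pochhammer_ratio_diff[OF this, of "real P"]
    have X0: "X \<noteq> 0"
      unfolding X_def using i assms by (intro pochhammer_neg_ne_0) (simp add: x_def)
    have nz: "L \<noteq> 0" "F \<noteq> 0" "x + 1 \<noteq> 0" "l + p \<noteq> 0" "l \<noteq> 0" "r + 1 \<noteq> 0" "l + r \<noteq> 0"
        "r - x \<noteq> 0"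
      using assms i pochhammer_pos[of "l" i] by (auto simp: L_def F_def x_def r_def p_def)
    \<comment> \<open>The parameters of \<open>alpha\<close> are brought back to those of
      \<open>beta\<close>, so that all terms become polynomials in \<open>r\<close> times a common
      factor.\<close>
    have "\<kappa>\<^sup>2 * (pochhammer (1 - \<kappa>) i * pochhammer (1 + \<kappa>) i) =
        - (pochhammer (- \<kappa>) (Suc i) * pochhammer \<kappa> (Suc i))"
      by (simp add: pochhammer_rec power2_eq_square add.commute)
    also have "\<dots> = C * D * (\<kappa>\<^sup>2 - r\<^sup>2)"
      by (simp add: pochhammer_Suc C_def D_def r_def power2_eq_square algebra_simps)
    finally have kk: "\<kappa>\<^sup>2 * (pochhammer (1 - \<kappa>) i * pochhammer (1 + \<kappa>) i) = C * D * (\<kappa>\<^sup>2 - r\<^sup>2)" .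
    have ll: "l * pochhammer (l + 1) i = L * (l + r)"
      by (simp add: pochhammer_rec[symmetric] pochhammer_Suc L_def r_def)
    have fS: "fact (Suc i) = (r + 1) * F"
      by (simp add: r_def F_def add.commute)
    have "c i = A * (\<kappa>\<^sup>2 * (pochhammer (1 - \<kappa>) i * pochhammer (1 + \<kappa>) i)) /
        ((l * pochhammer (l + 1) i) * fact (Suc i) * F)"
      by (simp add: c_def A_def F_def mult_ac)
    then have c: "c i = A * (C * D * (\<kappa>\<^sup>2 - r\<^sup>2)) / ((L * (l + r)) * ((r + 1) * F) * F)"
      by (simp only: kk ll fS)
    have XS: "pochhammer (- x) (Suc i) = X * (r - x)"
      by (simp add: X_def r_def pochhammer_Suc)
    have bi: "b i = \<kappa> / (l + p) * (B * C * D / (F * L * F)) * (A / X)"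
      by (simp add: b_def A_def B_def C_def D_def F_def L_def X_def p_def x_def add_ac)
    have gi: "g i = r\<^sup>2 * (A * B * C * D / (F * L * F * X))"
      by (simp add: g_def A_def B_def C_def D_def F_def L_def X_def r_def)
    have gS: "g (Suc i) = (A * (r - j)) * (B * (r - p)) * (C * (r - \<kappa>)) * (D * (\<kappa> + r)) /
        (F * (L * (l + r)) * F * (X * (r - x)))"
    proof -
      have "g (Suc i) = (r + 1)\<^sup>2 * ((A * (r - j)) * (B * (r - p)) * (C * (r - \<kappa>)) * (D * (\<kappa> + r)) /
        ((r + 1) * F * (L * (l + r)) * ((r + 1) * F) * (X * (r - x))))"
        unfolding g_def fS
        by (simp add: pochhammer_Suc A_def B_def C_def D_def L_def X_def r_def j_def p_def add.commute)
      then show ?thesis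
        using nz X0 by (simp add: divide_simps power2_eq_square) (simp add: mult_ac)
    qed
    have xP: "x = l + j + p"
      by (simp add: x_def j_def p_def)
    have "A * (C * D * (\<kappa>\<^sup>2 - r\<^sup>2)) / ((L * (l + r)) * ((r + 1) * F) * F) *
        - ((x - p) * (r + 1) * B / ((x + 1) * (X * (r - x)))) =
      \<kappa> / (x + 1) * (\<kappa> / (l + p) * (B * C * D / (F * L * F)) * (A / X)) +
      ((A * (r - j)) * (B * (r - p)) * (C * (r - \<kappa>)) * (D * (\<kappa> + r)) /
        (F * (L * (l + r)) * F * (X * (r - x))) - r\<^sup>2 * (A * B * C * D / (F * L * F * X))) /
        ((x + 1) * (l + p))" (is "?lhs = ?rhs")
    proof -
      \<comment> \<open>The common factor of all terms; what remains is a polynomial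
        identity.\<close>
      define E where "E = A * B * C * D / (F * F * L * X * (l + r) * (r - x) * (x + 1) * (l + p))"
      have "?lhs = - E * ((\<kappa>\<^sup>2 - r\<^sup>2) * (x - p) * (l + p))"
        unfolding E_def using nz X0 by (simp add: divide_simps)
      \<comment> \<open>Up to the factor \<kappa>^2 - r^2 this is (r - j)(r - p) - (l + r)(r - x) =
        (l + j)(l + p), valid as x = l + j + p.\<close>
      also have "(\<kappa>\<^sup>2 - r\<^sup>2) * (x - p) * (l + p) = - (\<kappa>\<^sup>2 * (l + r) * (r - x) +
          (r - j) * (r - p) * (r - \<kappa>) * (\<kappa> + r) - r\<^sup>2 * (l + r) * (r - x))"
        unfolding xP by algebra
      also have "- E * - (\<kappa>\<^sup>2 * (l + r) * (r - x) +
          (r - j) * (r - p) * (r - \<kappa>) * (\<kappa> + r) - r\<^sup>2 * (l + r) * (r - x)) =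
          E * (\<kappa>\<^sup>2 * (l + r) * (r - x)) + (E * ((r - j) * (r - p) * (r - \<kappa>) * (\<kappa> + r)) -
          E * (r\<^sup>2 * (l + r) * (r - x)))"
        by (simp add: algebra_simps)
      also have "E * (\<kappa>\<^sup>2 * (l + r) * (r - x)) =
          \<kappa> / (x + 1) * (\<kappa> / (l + p) * (B * C * D / (F * L * F)) * (A / X))"
        unfolding E_def using nz X0 by (simp add: divide_simps power2_eq_square)
      also have "E * ((r - j) * (r - p) * (r - \<kappa>) * (\<kappa> + r)) =
          (A * (r - j)) * (B * (r - p)) * (C * (r - \<kappa>)) * (D * (\<kappa> + r)) /
          (F * (L * (l + r)) * F * (X * (r - x))) / ((x + 1) * (l + p))"
        unfolding E_def by (simp add: mult_ac)
      also have "E * (r\<^sup>2 * (l + r) * (r - x)) =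
          r\<^sup>2 * (A * B * C * D / (F * L * F * X)) / ((x + 1) * (l + p))"
        unfolding E_def using nz X0 by (simp add: divide_simps)
      finally show ?thesis
        by (simp only: diff_divide_distrib)
    qed
    then show "c i * (pochhammer (- real P - 1) (Suc i) / pochhammer (- x - 1) (Suc i) -
         pochhammer (- real P) (Suc i) / pochhammer (- x) (Suc i)) =
        \<kappa> / (x + 1) * b i + (g (Suc i) - g i) / ((x + 1) * (l + real P))"
      unfolding d unfolding c XS bi gi gS r_def[symmetric] B_def[symmetric]
      unfolding p_def[symmetric] .
  qed
  also have "\<dots> = \<kappa> / (x + 1) * (\<Sum>i<Suc J. b i) + (g (Suc J) - g 0) / ((x + 1) * (l + real P))"
    by (simp only: sum.distrib sum_distrib_left[symmetric] sum_divide_distrib[symmetric]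
        sum_lessThan_telescope)
  also have "g (Suc J) = 0"
    by (simp add: g_def pochhammer_of_nat_eq_0_iff)
  also have "g 0 = 0"
    by (simp add: g_def)
  also have "(\<Sum>i<Suc J. b i) = beta \<kappa> l P J"
    unfolding b_def by (rule beta_eq_sum[symmetric]) simp
  finally show ?thesis
    by (simp add: x_def)
qed

section \<open>Expansion of both polynomials in monomials\<close>

lemma Q1_Q2_expansion:
  assumes "l > 0"
  shows "Q1 \<kappa> l n w v = w ^ n +
      (\<Sum>j<n. of_real (alpha \<kappa> l j (n - j)) * w ^ (n - Suc j) * v ^ Suc j)"
    and "Q2 \<kappa> l n w v = (\<Sum>j<Suc n. of_real (beta \<kappa> l j (n - j)) * w ^ (n - j) * v ^ j)"
\<comment> \<open>The induction is simultaneous and leaves \<open>w\<close> and \<open>v\<close>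
  free, as the recursion calls the other polynomial with the variables exchanged.\<close>
proof (induction n arbitrary: w v)
  case 0
  {
    case 1 show ?case by simp
  next
    case 2 show ?case by (simp add: beta_0_right)
  }
next
  case (Suc n)
  define c where "c = \<kappa> / (l + real n + 1)"
  {
    case 1
    have "(\<Sum>j<Suc n. of_real (alpha \<kappa> l j (Suc n - j)) * w ^ (Suc n - Suc j) * v ^ Suc j) =
        (\<Sum>j<Suc n. of_real (alpha \<kappa> l j (n - j)) * w ^ (n - j) * v ^ Suc j) +
        of_real c * v * (\<Sum>j<Suc n. of_real (beta \<kappa> l (n - j) j) * w ^ (n - j) * v ^ j)"
      unfolding sum_distrib_left sum.distrib[symmetric]
    proof (rule sum.cong[OF refl])
      fix j assume "j \<in> {..<Suc n}"
      then have "alpha \<kappa> l j (Suc n - j) = alpha \<kappa> l j (n - j) + c * beta \<kappa> l (n - j) j"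
        using alpha_Suc_right[OF assms, of \<kappa> j "n - j"] by (simp add: Suc_diff_le c_def)
      then show "of_real (alpha \<kappa> l j (Suc n - j)) * w ^ (Suc n - Suc j) * v ^ Suc j =
          of_real (alpha \<kappa> l j (n - j)) * w ^ (n - j) * v ^ Suc j +
          of_real c * v * (of_real (beta \<kappa> l (n - j) j) * w ^ (n - j) * v ^ j)"
        by (simp add: algebra_simps)
    qed
    \<comment> \<open>Reversing the order of summation undoes both the exchange of variables and
      that of the arguments of \<open>beta\<close>.\<close>
    also have "(\<Sum>j<Suc n. of_real (beta \<kappa> l (n - j) j) * w ^ (n - j) * v ^ j) = Q2 \<kappa> l n v w"
      unfolding Suc.IH(2)
      by (subst sum.nat_diff_reindex[symmetric]) (auto intro!: sum.cong simp: mult_ac)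
    \<comment> \<open>The term \<open>j = n\<close> is 0 by \<open>alpha_0_right\<close>; every
      other term contains a factor \<open>w\<close>.\<close>
    also have "(\<Sum>j<Suc n. of_real (alpha \<kappa> l j (n - j)) * w ^ (n - j) * v ^ Suc j) =
        w * (\<Sum>j<n. of_real (alpha \<kappa> l j (n - j)) * w ^ (n - Suc j) * v ^ Suc j)"
      unfolding sum_distrib_left sum.lessThan_Suc
      by (auto intro!: sum.cong simp: Suc_diff_Suc[symmetric] mult_ac)
    finally show ?case
      by (simp add: Suc.IH(1)[of w v] c_def algebra_simps)
  next
    case 2
    have "(\<Sum>j<Suc n. of_real (beta \<kappa> l j (Suc n - j)) * w ^ (Suc n - j) * v ^ j) =
        w * (\<Sum>j<Suc n. of_real (beta \<kappa> l j (n - j)) * w ^ (n - j) * v ^ j) +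
        of_real c * (\<Sum>j<Suc n. of_real (alpha \<kappa> l (n - j) j) * w ^ (Suc n - j) * v ^ j)"
      unfolding sum_distrib_left sum.distrib[symmetric]
    proof (rule sum.cong[OF refl])
      fix j assume "j \<in> {..<Suc n}"
      then have "beta \<kappa> l j (Suc n - j) = beta \<kappa> l j (n - j) + c * alpha \<kappa> l (n - j) j"
          and "Suc n - j = Suc (n - j)"
        using beta_Suc_right[OF assms, of \<kappa> j "n - j"] by (simp_all add: Suc_diff_le c_def)
      then show "of_real (beta \<kappa> l j (Suc n - j)) * w ^ (Suc n - j) * v ^ j =
          w * (of_real (beta \<kappa> l j (n - j)) * w ^ (n - j) * v ^ j) +
          of_real c * (of_real (alpha \<kappa> l (n - j) j) * w ^ (Suc n - j) * v ^ j)"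
        by (simp add: algebra_simps)
    qed
    \<comment> \<open>Here \<open>alpha_0_right\<close> removes the term
      \<open>j = 0\<close>.\<close>
    also have "(\<Sum>j<Suc n. of_real (alpha \<kappa> l (n - j) j) * w ^ (Suc n - j) * v ^ j) =
        (\<Sum>j<n. of_real (alpha \<kappa> l (n - Suc j) (Suc j)) * w ^ (n - j) * v ^ Suc j)"
      by (simp only: sum.lessThan_Suc_shift) simp
    also have "\<dots> = v * (\<Sum>j<n. of_real (alpha \<kappa> l j (n - j)) * v ^ (n - Suc j) * w ^ Suc j)"
      unfolding sum_distrib_left
      by (subst (2) sum.nat_diff_reindex[symmetric])
        (auto intro!: sum.cong simp: Suc_diff_Suc mult_ac)
    \<comment> \<open>The remaining top term has coefficient
      \<open>beta \<kappa> l (Suc n) 0 = c\<close>; it comes from the isolated power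
      \<open>v ^ n\<close> in \<open>Q1 \<kappa> l n v w\<close>.\<close>
    finally show ?case
      unfolding sum.lessThan_Suc[of _ "Suc n"]
      by (simp add: Suc.IH(1)[of v w] Suc.IH(2)[of w v] c_def beta_0_right algebra_simps
          del: sum.lessThan_Suc)
  }
qed

theorem proposition5:
  fixes \<kappa> lam :: real and n :: nat and w v :: complex
  assumes "lam > 0"
  shows "Q1 \<kappa> lam n w v = w ^ n +
      (\<Sum>j = 1..n. of_real (\<kappa>\<^sup>2 * (real n - real j + 1) / (lam * (lam + real n)) *
         hypergeo_terminating [1 - real j, real j - real n, 1 - \<kappa>, 1 + \<kappa>]
           [2, lam + 1, - lam - real n + 1] 1) * w ^ (n - j) * v ^ j)
    \<and> Q2 \<kappa> lam n w v =
      (\<Sum>j = 0..n. of_real (\<kappa> / (lam + real j) *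
         hypergeo_terminating [- real j, real j - real n, - \<kappa>, \<kappa>]
           [1, lam, - lam - real n] 1) * w ^ (n - j) * v ^ j)"
proof
  \<comment> \<open>The exponent of \<open>v\<close> becomes the summation index, one more than the
    first argument of \<open>alpha\<close>.\<close>
  have "(\<Sum>j<n. of_real (alpha \<kappa> lam j (n - j)) * w ^ (n - Suc j) * v ^ Suc j) =
      (\<Sum>j = 1..n. of_real (alpha \<kappa> lam (j - 1) (Suc n - j)) * w ^ (n - j) * v ^ j)"
    by (rule sum.reindex_bij_witness[of _ "\<lambda>j. j - 1" Suc]) auto
  also have "\<dots> = (\<Sum>j = 1..n. of_real (\<kappa>\<^sup>2 * (real n - real j + 1) / (lam * (lam + real n)) *
         hypergeo_terminating [1 - real j, real j - real n, 1 - \<kappa>, 1 + \<kappa>]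
           [2, lam + 1, - lam - real n + 1] 1) * w ^ (n - j) * v ^ j)"
    by (intro sum.cong refl) (auto simp: alpha_def of_nat_diff Suc_diff_le add.commute)
  finally show "Q1 \<kappa> lam n w v = w ^ n + \<dots>"
    using Q1_Q2_expansion(1)[OF assms] by simp
  show "Q2 \<kappa> lam n w v =
      (\<Sum>j = 0..n. of_real (\<kappa> / (lam + real j) *
         hypergeo_terminating [- real j, real j - real n, - \<kappa>, \<kappa>]
           [1, lam, - lam - real n] 1) * w ^ (n - j) * v ^ j)"
    unfolding Q1_Q2_expansion(2)[OF assms]
    by (intro sum.cong) (auto simp: beta_def of_nat_diff)
qed

end
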